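(* Let $N>0$ and $x\neq 0$ be real numbers, put $M=N^4+x$, and assume $M\ge 0$ and $\frac{7}{12}\frac{|x|}{N^4}<1$. Let $$E(x):=\sqrt[4]{M}-\left\{\frac{51}{56}N+\frac{5}{56}\frac{M}{N^3}+\frac{27Nx}{14(7M+5N^4)}\right\}.$$ Then there exists a number $X$ between $0$ and $\frac{x}{N^4}$ such that $$E(x)=-\frac{77}{2048}\left\{\frac{1}{(1+X)^{\frac{15}{4}}}-\frac{28}{33}\,\frac{1}{1+\frac{7}{12}\frac{x}{N^4}}\right\}\frac{x^4}{N^{15}}.$$ Moreover, if $$-\frac{20}{77}<\frac{x}{N^4}<t_0,$$ where $t_0=0.05336\ldots$ is the unique positive real solution $t$ of $\frac{1}{(1+t)^{15/4}}=\frac{28}{33}\,\frac{1}{1+\frac{7}{12}t}$, then the approximation overestimates the true value of $\sqrt[4]{M}$, that is, $$\frac{51}{56}N+\frac{5}{56}\frac{M}{N^3}+\frac{27Nx}{14(7M+5N^4)}>\sqrt[4]{M}.$$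
   Context: $\sqrt[4]{M}$ denotes the nonnegative real fourth root of $M\ge 0$. "Between $0$ and $\frac{x}{N^4}$" means strictly between: $0<X<\frac{x}{N^4}$ if $x>0$, and $\frac{x}{N^4}<X<0$ if $x<0$. *)

theory Defs
  imports Complex_Main
begin

definition fourth_root_approx :: "real \<Rightarrow> real \<Rightarrow> real" where
  "fourth_root_approx N x =
     (let M = N ^ 4 + x in
        51 / 56 * N + 5 / 56 * (M / N ^ 3) + 27 * N * x / (14 * (7 * M + 5 * N ^ 4)))"

definition approx_error :: "real \<Rightarrow> real \<Rightarrow> real" where
  "approx_error N x = root 4 (N ^ 4 + x) - fourth_root_approx N x"

definition threshold_eq :: "real \<Rightarrow> bool" where
  "threshold_eq t \<longleftrightarrow>
     1 / (1 + t) powr (15 / 4) = 28 / 33 * (1 / (1 + 7 / 12 * t))"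

text \<open>Meaningful only together with the unique existence of a positive solution,
  which the theorem asserts as part of its conclusion.\<close>

definition t\<^sub>0 :: real where
  "t\<^sub>0 = (THE t. t > 0 \<and> threshold_eq t)"

end

theory Submission
  imports Defs
begin

text \<open>Put \<open>s = x / N\<^sup>4\<close>; by homogeneity everything reduces to \<open>(1 + s) powr (1/4)\<close>. The rational
  approximation agrees with the Taylor expansion of this function at \<open>0\<close> up to order three, and its
  geometric remainder is \<open>49/1536 \<cdot> s\<^sup>4 / (1 + 7/12 \<cdot> s)\<close>; comparing it with the Lagrange remainder
  gives the error formula. For the sign, \<open>(1 + X) powr (-15/4)\<close> lies between its values at \<open>0\<close> and
  \<open>s\<close>, while \<open>28 (1 + t) powr (15/4) - 33 (1 + 7/12 \<cdot> t)\<close> is strictly increasing for \<open>t \<ge> 0\<close> and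
  vanishes at the threshold.\<close>

lemma powr_taylor4:
  fixes a s :: real
  assumes "s > -1" "s \<noteq> 0"
  shows "\<exists>X. (if s < 0 then s < X \<and> X < 0 else 0 < X \<and> X < s) \<and>
    (1 + s) powr a = 1 + a * s + a * (a - 1) / 2 * s ^ 2 + a * (a - 1) * (a - 2) / 6 * s ^ 3
       + a * (a - 1) * (a - 2) * (a - 3) / 24 * (1 + X) powr (a - 4) * s ^ 4"
proof -
  \<comment> \<open>The \<open>m\<close>-th derivative of \<open>(1 + y) powr a\<close>; the product
    is the falling factorial of \<open>a\<close>.\<close>
  define diff where "diff = (\<lambda>m y. (\<Prod>i<m. a - real i) * (1 + y) powr (a - real m))"
  have "\<exists>t. (if s < 0 then s < t \<and> t < 0 else 0 < t \<and> t < s) \<and>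
      (1 + s) powr a = (\<Sum>m<4. diff m 0 / fact m * (s - 0) ^ m) + diff 4 t / fact 4 * (s - 0) ^ 4"
  proof (rule Taylor[where a = "min s 0" and b = "max s 0"])
    show "diff 0 = (\<lambda>y. (1 + y) powr a)"
      by (simp add: diff_def)
    show "\<forall>m t. m < (4 :: nat) \<and> min s 0 \<le> t \<and> t \<le> max s 0 \<longrightarrow> (diff m has_real_derivative diff (Suc m) t) (at t)"
    proof (intro allI impI)
      fix m :: nat and t :: real assume "m < 4 \<and> min s 0 \<le> t \<and> t \<le> max s 0"
      then have "1 + t > 0" using assms by auto
      then show "(diff m has_real_derivative diff (Suc m) t) (at t)"
        unfolding diff_def
        by (auto intro!: derivative_eq_intros simp: algebra_simps)
    qed
  qed (use assms in auto)
  then show ?thesis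
    by (auto simp: diff_def eval_nat_numeral lessThan_Suc algebra_simps)
qed

text \<open>The case \<open>a = 1/4\<close> of the Taylor formula, extended to
  \<open>s = -1\<close>, because \<open>M = 0\<close> is admissible.\<close>

lemma root4_taylor:
  fixes s :: real
  assumes "s \<ge> -1" "s \<noteq> 0"
  shows "\<exists>X. (if s < 0 then s < X \<and> X < 0 else 0 < X \<and> X < s) \<and>
    root 4 (1 + s) = 1 + s / 4 - 3 / 32 * s ^ 2 + 7 / 128 * s ^ 3
       - 77 / 2048 * (1 / (1 + X) powr (15 / 4)) * s ^ 4"
proof (cases "s = -1")
  case True
  \<comment> \<open>The fourth root is not differentiable at \<open>0\<close>, but here \<open>X\<close> is determined by
    \<open>(1 + X) powr (15/4) = 1/16\<close>.\<close>
  define X :: real where "X = (1 / 16) powr (4 / 15) - 1"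
  have "(1 / 16 :: real) powr (4 / 15) < 1 powr (4 / 15)"
    by (rule powr_less_mono2) auto
  moreover have "(1 + X) powr (15 / 4) = 1 / 16"
    by (simp add: X_def powr_powr)
  ultimately show ?thesis
    using True by (intro exI[of _ X]) (auto simp: X_def)
next
  case False
  then have "s > -1" using assms by auto
  from powr_taylor4[OF this assms(2), of "1/4"] obtain X
    where X: "if s < 0 then s < X \<and> X < 0 else 0 < X \<and> X < s"
      and eq: "(1 + s) powr (1 / 4) = 1 + s / 4 - 3 / 32 * s ^ 2 + 7 / 128 * s ^ 3
         - 77 / 2048 * (1 + X) powr (- (15 / 4)) * s ^ 4"
    by auto
  have "root 4 (1 + s) = (1 + s) powr (1 / 4)"
    using \<open>s > -1\<close> by (simp add: root_powr_inverse)
  then show ?thesis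
    using X eq by (intro exI[of _ X]) (simp add: powr_minus_divide)
qed

text \<open>The fraction is \<open>9/56 * s / (1 + 7/12 * s)\<close>, a geometric series with ratio
  \<open>- 7/12 * s\<close>. Cutting it after \<open>s ^ 3\<close> leaves an exact tail; its
  coefficient 49/1536 is written as 77/2048 * 28/33 to share a factor with the Lagrange
  remainder.\<close>

lemma rational_approx_remainder:
  fixes s :: real
  assumes "12 + 7 * s \<noteq> 0"
  shows "51 / 56 + 5 / 56 * (1 + s) + 27 * s / (14 * (12 + 7 * s)) =
    1 + s / 4 - 3 / 32 * s ^ 2 + 7 / 128 * s ^ 3 - 77 / 2048 * (28 / 33 * (1 / (1 + 7 / 12 * s))) * s ^ 4"
proof -
  have "1 + 7 / 12 * s = (12 + 7 * s) / 12" by simp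
  then show ?thesis
    using assms by (simp only:) (simp add: divide_simps, algebra)
qed

lemma fourth_root_approx_scale:
  fixes N s :: real
  assumes "N > 0"
  shows "fourth_root_approx N (N ^ 4 * s) =
    N * (51 / 56 + 5 / 56 * (1 + s) + 27 * s / (14 * (12 + 7 * s)))"
proof -
  have "(N ^ 4 + N ^ 4 * s) / N ^ 3 = N * (1 + s)"
    using assms by (simp add: field_simps eval_nat_numeral)
  moreover have "27 * N * (N ^ 4 * s) / (14 * (7 * (N ^ 4 + N ^ 4 * s) + 5 * N ^ 4)) =
      (N ^ 4 * (27 * N * s)) / (N ^ 4 * (14 * (12 + 7 * s)))"
    by (simp add: algebra_simps)
  then have "27 * N * (N ^ 4 * s) / (14 * (7 * (N ^ 4 + N ^ 4 * s) + 5 * N ^ 4)) =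
      N * (27 * s / (14 * (12 + 7 * s)))"
    using assms by (simp only: mult_divide_mult_cancel_left_if) simp
  ultimately show ?thesis
    unfolding fourth_root_approx_def Let_def by (simp only:) (simp add: algebra_simps)
qed

text \<open>The threshold equation with denominators cleared. For t \<ge> 0, a negative value means
  that the rational side is the smaller one.\<close>

definition threshold_fun :: "real \<Rightarrow> real" where
  "threshold_fun t = 28 * (1 + t) powr (15 / 4) - 33 * (1 + 7 / 12 * t)"

lemma threshold_eq_iff:
  assumes "t \<ge> 0"
  shows "threshold_eq t \<longleftrightarrow> threshold_fun t = 0"
proof -
  have "(1 + t) powr (15 / 4) > 0" "1 + 7 / 12 * t > 0" using assms by auto
  then show ?thesis
    unfolding threshold_eq_def threshold_fun_def by (simp add: divide_simps) argo
qed

text \<open>From \<open>a\<close> to \<open>b\<close> the power grows by at least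
  \<open>b - a\<close>, and 28 exceeds the slope 33 * 7/12 = 77/4 of the linear term.\<close>

lemma threshold_fun_strict_mono:
  assumes "0 \<le> a" "a < b"
  shows "threshold_fun a < threshold_fun b"
proof -
  have split: "(1 + t) powr (15 / 4) = (1 + t) * (1 + t) powr (11 / 4)" if "t \<ge> 0" for t :: real
    using that powr_add[of "1 + t" 1 "11 / 4"] by simp
  have "(1 + a) powr (11 / 4) \<le> (1 + b) powr (11 / 4)"
    using assms by (intro powr_mono2) auto
  then have "(1 + b) * (1 + a) powr (11 / 4) \<le> (1 + b) powr (15 / 4)"
    using assms by (simp add: split)
  moreover have "1 \<le> (1 + a) powr (11 / 4)"
    using assms by (intro ge_one_powr_ge_zero) auto
  then have "(b - a) * 1 \<le> (b - a) * (1 + a) powr (11 / 4)"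
    using assms by (intro mult_left_mono) auto
  ultimately have "b - a \<le> (1 + b) powr (15 / 4) - (1 + a) powr (15 / 4)"
    using assms by (simp add: split algebra_simps)
  then show ?thesis
    using assms unfolding threshold_fun_def by argo
qed

text \<open>Taking fourth powers turns the numerical bounds on the threshold into rational
  arithmetic.\<close>

lemma powr_fifteen_quarters_power4:
  assumes "(u :: real) > 0"
  shows "(u powr (15 / 4)) ^ 4 = u ^ 15"
proof -
  have "(u powr (15 / 4)) ^ 4 = u powr (real 15)"
    using assms by (subst powr_power) auto
  also have "\<dots> = u ^ 15"
    by (rule powr_realpow) (fact assms)
  finally show ?thesis .
qed

lemma threshold_fun_lower: "threshold_fun 0.05336 < 0"
proof -
  have "((1 + 0.05336 :: real) powr (15 / 4)) ^ 4 < (33 / 28 * (1 + 7 / 12 * 0.05336)) ^ 4"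
    by (subst powr_fifteen_quarters_power4) (auto simp: power_divide divide_simps)
  from power_less_imp_less_base[OF this] show ?thesis
    by (simp add: threshold_fun_def)
qed

lemma threshold_fun_upper: "threshold_fun 0.05337 > 0"
proof -
  have "(33 / 28 * (1 + 7 / 12 * 0.05337)) ^ 4 < ((1 + 0.05337 :: real) powr (15 / 4)) ^ 4"
    by (subst powr_fifteen_quarters_power4) (auto simp: power_divide divide_simps)
  from power_less_imp_less_base[OF this] show ?thesis
    by (simp add: threshold_fun_def)
qed

text \<open>The sign change gives a zero in the bracket; strict monotonicity makes it the only
  positive one, so the description defining \<open>t\<^sub>0\<close> denotes it.\<close>

lemma threshold_unique_bracketed:
  shows "\<exists>!t. t > 0 \<and> threshold_eq t"
    and "0.05336 < t\<^sub>0" "t\<^sub>0 < 0.05337" "threshold_fun t\<^sub>0 = 0"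
proof -
  have "continuous_on {0.05336..0.05337} threshold_fun"
    unfolding threshold_fun_def by (intro continuous_intros) auto
  then obtain t where t: "0.05336 \<le> t" "t \<le> 0.05337" "threshold_fun t = 0"
    using IVT'[of threshold_fun "0.05336" 0 "0.05337"] threshold_fun_lower threshold_fun_upper by auto
  show ex1: "\<exists>!t. t > 0 \<and> threshold_eq t"
  proof (rule ex1I)
    show "t > 0 \<and> threshold_eq t" using t by (auto simp: threshold_eq_iff)
    show "u = t" if "u > 0 \<and> threshold_eq u" for u
      using that t threshold_fun_strict_mono[of u t] threshold_fun_strict_mono[of t u]
      by (cases u t rule: linorder_cases) (auto simp: threshold_eq_iff)
  qed
  have "t\<^sub>0 = t"
    unfolding t\<^sub>0_def using ex1 t by (intro the1_equality) (auto simp: threshold_eq_iff)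
  moreover have "t \<noteq> 0.05336" "t \<noteq> 0.05337"
    using t(3) threshold_fun_lower threshold_fun_upper by (metis less_irrefl)+
  ultimately show "0.05336 < t\<^sub>0" "t\<^sub>0 < 0.05337" "threshold_fun t\<^sub>0 = 0"
    using t by auto
qed

lemma error_bracket_pos:
  fixes s X :: real
  assumes "- (20 / 77) < s" "s < t\<^sub>0"
    and X: "if s < 0 then s < X \<and> X < 0 else 0 < X \<and> X < s"
  shows "28 / 33 * (1 / (1 + 7 / 12 * s)) < 1 / (1 + X) powr (15 / 4)"
proof (cases "s < 0")
  case True
  then have "-1 < X" "X < 0" using X assms by auto
  then have "(1 + X) powr (15 / 4) < 1 powr (15 / 4)" "0 < (1 + X) powr (15 / 4)"
    using powr_less_mono2[of "15 / 4" "1 + X" 1] by auto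
  then have "1 < 1 / (1 + X) powr (15 / 4)" by simp
  \<comment> \<open>The bound -20/77 is exactly where this expression equals 1.\<close>
  moreover have "28 / 33 * (1 / (1 + 7 / 12 * s)) < 1"
    using assms by (simp add: divide_simps)
  ultimately show ?thesis by linarith
next
  case False
  then have "0 < X" "X < s" using X by auto
  then have "(1 + X) powr (15 / 4) < (1 + s) powr (15 / 4)" "0 < (1 + X) powr (15 / 4)"
    by (auto intro: powr_less_mono2)
  \<comment> \<open>Since \<open>X < s\<close>, it suffices to compare both sides at
    \<open>s\<close>, which lies below the zero \<open>t\<^sub>0\<close>.\<close>
  moreover have "threshold_fun s < 0"
    using threshold_fun_strict_mono[of s "t\<^sub>0"] threshold_unique_bracketed(4) assms False by auto
  ultimately show ?thesis
    using False unfolding threshold_fun_def by (simp add: divide_simps)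
qed

theorem theorem2p1:
  fixes N x M :: real
  assumes "N > 0" and "x \<noteq> 0" and "M = N ^ 4 + x" and "M \<ge> 0"
    and "7 / 12 * (\<bar>x\<bar> / N ^ 4) < 1"
  shows "(\<exists>X. ((x > 0 \<longrightarrow> 0 < X \<and> X < x / N ^ 4) \<and> (x < 0 \<longrightarrow> x / N ^ 4 < X \<and> X < 0)) \<and>
            approx_error N x =
              - (77 / 2048) *
                (1 / (1 + X) powr (15 / 4) - 28 / 33 * (1 / (1 + 7 / 12 * (x / N ^ 4)))) *
                (x ^ 4 / N ^ 15)) \<and>
         (\<exists>!t. t > 0 \<and> threshold_eq t) \<and>
         0.05336 \<le> t\<^sub>0 \<and> t\<^sub>0 < 0.05337 \<and>
         (- (20 / 77) < x / N ^ 4 \<and> x / N ^ 4 < t\<^sub>0 \<longrightarrow> fourth_root_approx N x > root 4 M)"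
proof -
  define s where "s = x / N ^ 4"
  have x: "x = N ^ 4 * s" using assms(1) by (simp add: s_def)
  have M: "M = N ^ 4 * (1 + s)" by (simp add: assms(3) x algebra_simps)
  have "s \<noteq> 0" using assms by (simp add: s_def)
  moreover have "s \<ge> -1"
    using assms(1,4) by (simp add: M zero_le_mult_iff)
  ultimately obtain X
    where X: "if s < 0 then s < X \<and> X < 0 else 0 < X \<and> X < s"
      and root: "root 4 (1 + s) = 1 + s / 4 - 3 / 32 * s ^ 2 + 7 / 128 * s ^ 3
         - 77 / 2048 * (1 / (1 + X) powr (15 / 4)) * s ^ 4"
    using root4_taylor by blast
  define B where "B = 1 / (1 + X) powr (15 / 4) - 28 / 33 * (1 / (1 + 7 / 12 * s))"
  have scale: "x ^ 4 / N ^ 15 = N * s ^ 4"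
    using assms(1) by (simp add: x field_simps eval_nat_numeral)
  have "12 + 7 * s \<noteq> 0" using \<open>s \<ge> -1\<close> by auto
  moreover have "root 4 M = N * root 4 (1 + s)"
    using assms(1) by (simp add: M real_root_mult real_root_power_cancel)
  \<comment> \<open>Here \<open>P\<close> stands for the common cubic Taylor polynomial, which
    cancels; \<open>a\<close> and \<open>b\<close> are the two remainder factors and
    \<open>q\<close> is \<open>s ^ 4\<close>.\<close>
  moreover have "N * (P - c * a * q) - N * (P - c * b * q) = - c * (a - b) * (N * q)"
    for P a b c q :: real
    by (simp add: algebra_simps)
  ultimately have "root 4 M - fourth_root_approx N x = - (77 / 2048) * B * (N * s ^ 4)"
    unfolding B_def x fourth_root_approx_scale[OF assms(1)]
    by (simp only: rational_approx_remainder root not_False_eq_True)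
  then have err: "root 4 M - fourth_root_approx N x = - (77 / 2048) * B * (x ^ 4 / N ^ 15)"
    by (simp only: scale)
  have "fourth_root_approx N x > root 4 M" if "- (20 / 77) < s" "s < t\<^sub>0"
  proof -
    \<comment> \<open>A positive bracket makes the error negative.\<close>
    have "B > 0" using error_bracket_pos[OF that X] by (simp add: B_def)
    moreover have "x ^ 4 / N ^ 15 > 0"
      unfolding scale using assms(1) \<open>s \<noteq> 0\<close> by simp
    ultimately have "B * (x ^ 4 / N ^ 15) > 0" by (rule mult_pos_pos)
    with err show ?thesis by linarith
  qed
  moreover have "s < 0 \<longleftrightarrow> x < 0" "s > 0 \<longleftrightarrow> x > 0"
    using assms(1) by (auto simp: s_def divide_less_0_iff zero_less_divide_iff)
  ultimately show ?thesis
    using X err threshold_unique_bracketed(1-3)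
    unfolding B_def s_def[symmetric] approx_error_def assms(3)
    by (intro conjI exI[of _ X]) auto
qed

end
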